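(* For $k=0$ or $k=1$ and every integer $n\geq 39$, \[M_k(n-1)+M_k(n+1)>2M_k(n).\]
   Context: For a partition $\lambda$ of a positive integer, let $\omega(\lambda)$ be the number of parts equal to $1$ and let $\nu(\lambda)$ be the number of parts of $\lambda$ strictly larger than $\omega(\lambda)$. The crank of $\lambda$ is its largest part if $\omega(\lambda)=0$, and $\nu(\lambda)-\omega(\lambda)$ if $\omega(\lambda)>0$. For $n\geq 0$, $M_0(n)$ (resp. $M_1(n)$) denotes the number of partitions of $n$ with even (resp. odd) crank. *)

theory Defs
  imports Main "HOL-Library.Multiset"
begin

definition partitions_of :: "nat \<Rightarrow> nat multiset set" where
  "partitions_of n = {p. 0 \<notin># p \<and> \<Sum>\<^sub># p = n}"

definition num_ones :: "nat multiset \<Rightarrow> nat" where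
  "num_ones p = count p 1"

definition num_large :: "nat multiset \<Rightarrow> nat" where
  "num_large p = size {#x \<in># p. x > num_ones p#}"

(* The inserted 0 only matters for the empty partition, whose largest part
   (and hence crank) is 0 by convention. *)
definition largest_part :: "nat multiset \<Rightarrow> nat" where
  "largest_part p = Max (insert 0 (set_mset p))"

definition crank :: "nat multiset \<Rightarrow> int" where
  "crank p = (if num_ones p = 0 then int (largest_part p)
              else int (num_large p) - int (num_ones p))"

(* M 0 n and M 1 n count the partitions of n with even and odd crank;
   "mod" on int is nonnegative, so this also covers negative cranks. *)
definition M :: "nat \<Rightarrow> nat \<Rightarrow> nat" where
  "M k n = card {p \<in> partitions_of n. crank p mod 2 = int k}"

lemma finite_partitions_of: "finite (partitions_of n)"
proof -
  have "partitions_of n \<subseteq> mset ` {xs. set xs \<subseteq> {..n} \<and> length xs \<le> n}"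
  proof
    fix p assume p: "p \<in> partitions_of n"
    obtain xs where xs: "p = mset xs" using ex_mset by metis
    have pos: "0 \<notin> set xs" and sum: "sum_list xs = n"
      using p by (simp_all add: partitions_of_def xs sum_mset_sum_list)
    have "length ys \<le> sum_list ys" if "0 \<notin> set ys" for ys :: "nat list"
      using that by (induction ys) auto
    then have "length xs \<le> n" using pos sum by blast
    moreover have "set xs \<subseteq> {..n}" using member_le_sum_list sum by auto
    ultimately show "p \<in> mset ` {xs. set xs \<subseteq> {..n} \<and> length xs \<le> n}"
      using xs by blast
  qed
  then show ?thesis
    using finite_subset finite_lists_length_le[of "{..n}" n] by blast
qed

end

theory Submission imports Defs "HOL-Computational_Algebra.Formal_Power_Series" begin

text \<open>
  Let p(n) = M_0(n) + M_1(n) be the number of partitions of n and a(n) = M_0(n) - M_1(n).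
  Splitting the partitions by their number of ones and applying the q-binomial theorem twice gives
  the generating function (q;q)/(-q;q)^2 of a(n), up to its coefficients at n < 2.
  By the theorems of Gauss and Euler this equals (sum over s of (-1)^s q^(s^2)) (q;q^2), so
  the second difference of a(n) is bounded in absolute value by the coefficients of
  (1+q)^2 (sum over s of q^(s^2)) (-q;q^2), whereas that of p(n) has generating function
  (1-q)^2/(q;q). It remains to compare the coefficients of these two series from index 40 on.
  Both are built up factor by factor: the second series receives a factor 1/(1-q^K) whenever the
  first receives 1 + q^K, hence it gains more at every n except for a bounded loss inherited from
  the finitely many indices below 40. A large margin at K = 12 pays for these losses.
\<close>

unbundle fps_syntax

abbreviation q :: "int fps" where "q \<equiv> fps_X"

section \<open>Geometric series and their coefficient recursion\<close>

lemma fps_nth_q_power_mult: "(q ^ m * F) $ n = (if m \<le> n then F $ (n - m) else 0)"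
  by (simp add: fps_X_power_mult_nth)

text \<open>For \<open>m > 0\<close> this is 1/(1 - c q^m), which generates the multiplicity of the
  part m when each copy has weight c.\<close>

definition geom :: "int \<Rightarrow> nat \<Rightarrow> int fps" where
  "geom c m = Abs_fps (\<lambda>n. if m dvd n then c ^ (n div m) else 0)"

lemma geom_mult_cancel:
  assumes "m > 0"
  shows "geom c m * (1 - fps_const c * q ^ m) = 1"
proof (rule fps_ext)
  fix n
  have "(geom c m * (1 - fps_const c * q ^ m)) $ n
      = geom c m $ n - c * (q ^ m * geom c m) $ n"
    by (simp add: algebra_simps)
  also have "\<dots> = 1 $ n"
  proof (cases "m \<le> n")
    case True
    then obtain k where n: "n = m + k" using le_Suc_ex by blast
    have "(m + k) div m = Suc (k div m)" using assms by simp
    then show ?thesis using assms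
      by (simp only: fps_nth_q_power_mult) (auto simp: geom_def n)
  next
    case False
    then have "m dvd n \<longleftrightarrow> n = 0" using dvd_imp_le by force
    with False assms show ?thesis
      by (simp only: fps_nth_q_power_mult) (auto simp: geom_def)
  qed
  finally show "(geom c m * (1 - fps_const c * q ^ m)) $ n = 1 $ n" .
qed

lemma geom_1_cancel: "m > 0 \<Longrightarrow> geom 1 m * (1 - q ^ m) = 1"
  and geom_minus_1_cancel: "m > 0 \<Longrightarrow> geom (-1) m * (1 + q ^ m) = 1"
  using geom_mult_cancel[of m 1] geom_mult_cancel[of m "-1"]
  by (simp_all add: fps_const_neg[symmetric] del: fps_const_neg)

text \<open>Multiply by 1 - c q^m and compare coefficients. The counting of partitions and the
  growth estimates rest on this recursion instead of the convolution formula.\<close>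

lemma nth_mult_geom:
  assumes "m > 0"
  shows "(F * geom c m) $ n = F $ n + (if m \<le> n then c * (F * geom c m) $ (n - m) else 0)"
proof -
  have "F = F * (geom c m * (1 - fps_const c * q ^ m))"
    using geom_mult_cancel[OF assms] by simp
  also have "\<dots> = F * geom c m - fps_const c * (q ^ m * (F * geom c m))"
    by (simp add: algebra_simps)
  finally have "F $ n = (F * geom c m) $ n - c * (q ^ m * (F * geom c m)) $ n"
    by (metis fps_mult_left_const_nth fps_sub_nth)
  then show ?thesis by (simp add: fps_nth_q_power_mult)
qed

section \<open>Partitions by crank parity\<close>

definition parts_in :: "nat set \<Rightarrow> nat \<Rightarrow> nat multiset set" where
  "parts_in S n = {p. set_mset p \<subseteq> S \<and> \<Sum>\<^sub># p = n}"

lemma parts_in_subset_partitions: "0 \<notin> S \<Longrightarrow> parts_in S n \<subseteq> partitions_of n"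
  by (auto simp: parts_in_def partitions_of_def)

lemma finite_parts_in: "0 \<notin> S \<Longrightarrow> finite (parts_in S n)"
  using finite_subset[OF parts_in_subset_partitions finite_partitions_of] by blast

lemma parts_in_insert:
  assumes "m \<notin> S"
  shows "parts_in (insert m S) n =
    parts_in S n \<union> (if m \<le> n then add_mset m ` parts_in (insert m S) (n - m) else {})"
    (is "?L = ?R")
proof
  show "?L \<subseteq> ?R"
  proof
    fix p assume p: "p \<in> ?L"
    show "p \<in> ?R"
    proof (cases "m \<in># p")
      case True
      then obtain r where r: "p = add_mset m r" by (metis insert_DiffM)
      with p have "r \<in> parts_in (insert m S) (n - m)" "m \<le> n" by (auto simp: parts_in_def)
      then show ?thesis using r by auto
    qed (use p in \<open>auto simp: parts_in_def\<close>)
  qed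
  show "?R \<subseteq> ?L" by (auto simp: parts_in_def split: if_splits)
qed

text \<open>A partition either avoids the part m or arises from one of \<open>n - m\<close> by
  adding a copy of m, which is the recursion of \<open>nth_mult_geom\<close>. General weights are
  kept so that large parts can carry a sign.\<close>

lemma sum_parts_in:
  assumes "finite S" "0 \<notin> S"
  shows "(\<Sum>p\<in>parts_in S n. \<Prod>x\<in>#p. w x) = (\<Prod>m\<in>S. geom (w m) m) $ n"
  using assms
proof (induction S arbitrary: n rule: finite_induct)
  case empty
  have "parts_in {} n = (if n = 0 then {{#}} else {})" by (auto simp: parts_in_def)
  then show ?case by simp
next
  case (insert m S)
  from insert.prems have m: "m > 0" and S: "0 \<notin> S" by auto
  let ?f = "\<lambda>n. \<Sum>p\<in>parts_in (insert m S) n. \<Prod>x\<in>#p. w x"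
  have rec: "?f n = (\<Prod>m\<in>S. geom (w m) m) $ n + (if m \<le> n then w m * ?f (n - m) else 0)" for n
  proof (cases "m \<le> n")
    case True
    have "m \<notin># p" if "p \<in> parts_in S n" for p
      using that \<open>m \<notin> S\<close> by (auto simp: parts_in_def)
    then have disj: "parts_in S n \<inter> add_mset m ` parts_in (insert m S) (n - m) = {}"
      by fastforce
    have "?f n = (\<Sum>p\<in>parts_in S n. \<Prod>x\<in>#p. w x)
        + (\<Sum>p\<in>add_mset m ` parts_in (insert m S) (n - m). \<Prod>x\<in>#p. w x)"
      by (subst parts_in_insert[OF \<open>m \<notin> S\<close>])
        (use True disj insert.prems S in \<open>simp add: sum.union_disjoint finite_parts_in\<close>)
    also have "(\<Sum>p\<in>add_mset m ` parts_in (insert m S) (n - m). \<Prod>x\<in>#p. w x) = w m * ?f (n - m)"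
      by (subst sum.reindex) (auto simp: inj_on_def sum_distrib_left)
    finally show ?thesis using True insert.IH[OF S] by simp
  next
    case False
    then show ?thesis
      by (subst parts_in_insert[OF \<open>m \<notin> S\<close>]) (simp add: insert.IH[OF S])
  qed
  have "?f n = ((\<Prod>m\<in>S. geom (w m) m) * geom (w m) m) $ n"
  proof (induction n rule: less_induct)
    case (less n)
    then show ?case
      by (subst rec, subst nth_mult_geom[OF m]) (use m in auto)
  qed
  then show ?case using insert.hyps by (simp add: mult.commute)
qed

lemma card_parts_in:
  assumes "finite S" "0 \<notin> S"
  shows "int (card (parts_in S n)) = (\<Prod>m\<in>S. geom 1 m) $ n"
  using sum_parts_in[OF assms, of "\<lambda>_. 1"] by simp

definition crank_sign :: "nat multiset \<Rightarrow> int" where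
  "crank_sign p = (if even (crank p) then 1 else - 1)"

lemma M_eq_card: "k < 2 \<Longrightarrow> M k n = card {p \<in> partitions_of n. even (crank p) = even k}"
proof -
  assume "k < 2"
  then have "crank p mod 2 = int k \<longleftrightarrow> even (crank p) = even k" for p
    by (auto simp: less_2_cases_iff even_iff_mod_2_eq_zero)
  then show ?thesis by (simp add: M_def)
qed

lemma M_add: "M 0 n + M 1 n = card (partitions_of n)"
proof -
  have "partitions_of n = {p \<in> partitions_of n. even (crank p)} \<union> {p \<in> partitions_of n. odd (crank p)}"
    by auto
  then show ?thesis
    by (simp add: M_eq_card) (metis (no_types, lifting) finite_partitions_of card_Un_disjoint
        disjoint_iff finite_Un mem_Collect_eq)
qed

lemma M_diff: "int (M 0 n) - int (M 1 n) = (\<Sum>p\<in>partitions_of n. crank_sign p)"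
  by (simp add: M_eq_card crank_sign_def sum.If_cases finite_partitions_of Int_def)

lemma partitions_of_eq_parts_in: "partitions_of n = parts_in {1..n} n"
proof -
  have "x \<in># p \<Longrightarrow> x \<le> \<Sum>\<^sub># p" for x and p :: "nat multiset"
    by (induction p) auto
  moreover have "0 \<notin># p \<longleftrightarrow> (\<forall>x\<in>#p. 1 \<le> x)" for p :: "nat multiset"
    by (auto simp: Suc_le_eq intro: gr0I)
  ultimately show ?thesis unfolding partitions_of_def parts_in_def by fastforce
qed

text \<open>Without ones the crank is the largest part m, so the partitions are sorted by m and one
  copy of it is split off.\<close>

lemma partitions_without_ones:
  assumes "n > 0"
  shows "{p \<in> partitions_of n. num_ones p = 0} = (\<Union>m\<in>{2..n}. add_mset m ` parts_in {2..m} (n - m))"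
    (is "?L = ?R")
proof (rule subset_antisym)
  show "?L \<subseteq> ?R"
  proof
    fix p assume p: "p \<in> ?L"
    then have sub: "set_mset p \<subseteq> {1..n}" and sum: "\<Sum>\<^sub># p = n" and one: "1 \<notin># p"
      by (auto simp: partitions_of_eq_parts_in parts_in_def num_ones_def not_in_iff)
    define m where "m = Max (set_mset p)"
    have ne: "set_mset p \<noteq> {}" using sum assms by auto
    then have m: "m \<in># p" unfolding m_def by simp
    have "x \<in> {2..m}" if "x \<in># p" for x
    proof -
      have "x \<noteq> 1" using that one by metis
      then show ?thesis using that sub by (auto simp: m_def)
    qed
    then have "p - {#m#} \<in> parts_in {2..m} (n - m)"
      using sum m by (auto simp: parts_in_def sum_mset_diff dest: in_diffD)
    moreover have "p = add_mset m (p - {#m#})" using m by simp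
    moreover have "m \<in> {2..n}" using m sub \<open>\<And>x. x \<in># p \<Longrightarrow> x \<in> {2..m}\<close> by fastforce
    ultimately show "p \<in> ?R" by blast
  qed
  show "?R \<subseteq> ?L"
  proof
    fix p assume "p \<in> ?R"
    then obtain m r where "m \<in> {2..n}" "r \<in> parts_in {2..m} (n - m)" "p = add_mset m r" by blast
    then show "p \<in> ?L"
      by (auto simp: partitions_of_def parts_in_def num_ones_def count_eq_zero_iff)
  qed
qed

lemma partitions_with_ones:
  assumes "j > 0"
  shows "{p \<in> partitions_of n. num_ones p = j}
    = (if j \<le> n then (\<lambda>r. replicate_mset j 1 + r) ` parts_in {2..n} (n - j) else {})" (is "?L = ?R")
proof (rule subset_antisym)
  show "?L \<subseteq> ?R"
  proof
    fix p assume p: "p \<in> ?L"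
    then have sub: "set_mset p \<subseteq> {1..n}" and sum: "\<Sum>\<^sub># p = n" and j: "count p 1 = j"
      by (auto simp: partitions_of_eq_parts_in parts_in_def num_ones_def)
    let ?r = "filter_mset (\<lambda>x. x \<noteq> 1) p"
    have eq: "p = replicate_mset j 1 + ?r"
      using j by (intro multiset_eqI) auto
    have "n = j + \<Sum>\<^sub># ?r"
      using sum by (subst (asm) eq) simp
    moreover have "set_mset ?r \<subseteq> {2..n}"
    proof
      fix x assume "x \<in># ?r"
      then have "x \<in># p" "x \<noteq> 1" by auto
      moreover from this sub have "x \<in> {1..n}" by blast
      ultimately show "x \<in> {2..n}" by simp
    qed
    ultimately have "?r \<in> parts_in {2..n} (n - j)" "j \<le> n" by (simp_all add: parts_in_def)
    with eq show "p \<in> ?R" by auto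
  qed
  show "?R \<subseteq> ?L"
  proof
    fix p assume "p \<in> ?R"
    then obtain r where r: "j \<le> n" "r \<in> parts_in {2..n} (n - j)" "p = replicate_mset j 1 + r"
      by (auto split: if_splits)
    then have "count r 1 = 0" "count r 0 = 0" by (auto simp: parts_in_def count_eq_zero_iff)
    with r show "p \<in> ?L"
      by (auto simp: partitions_of_def parts_in_def num_ones_def simp flip: count_greater_zero_iff)
  qed
qed

lemma prod_mset_sign:
  "(\<Prod>x\<in>#r. if P x then - 1 else 1 :: int) = (- 1) ^ size {#x \<in># r. P x#}"
  by (induction r) auto

lemma crank_sign_no_ones:
  assumes "2 \<le> m" "r \<in> parts_in {2..m} k"
  shows "crank_sign (add_mset m r) = (- 1) ^ m"
proof -
  have "num_ones (add_mset m r) = 0"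
    using assms by (auto simp: num_ones_def parts_in_def count_eq_zero_iff)
  moreover have "largest_part (add_mset m r) = m"
    unfolding largest_part_def using assms by (intro Max_eqI) (auto simp: parts_in_def)
  ultimately show ?thesis by (simp add: crank_sign_def crank_def minus_one_power_iff)
qed

text \<open>Modulo 2 the crank is the number of ones plus the number of large parts, and the sign of
  the latter is a product over the parts. The ones themselves are never large because
  \<open>j > 0\<close>.\<close>

lemma crank_sign_ones:
  assumes "j > 0" "r \<in> parts_in {2..n} k"
  shows "crank_sign (replicate_mset j 1 + r)
    = (- 1) ^ j * (\<Prod>x\<in>#r. if j < x then - 1 else 1)"
proof -
  have "count r 1 = 0" using assms by (auto simp: parts_in_def count_eq_zero_iff)
  then have ones: "num_ones (replicate_mset j 1 + r) = j"
    by (simp add: num_ones_def)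
  have "filter_mset (\<lambda>x. j < x) (replicate_mset j 1) = {#}"
    using assms by (intro multiset_eqI) (auto simp: Suc_le_eq)
  then have "num_large (replicate_mset j 1 + r) = size {#x \<in># r. j < x#}"
    unfolding num_large_def ones filter_union_mset by (simp only: empty_neutral)
  then show ?thesis using assms
    by (simp add: crank_sign_def crank_def ones prod_mset_sign minus_one_power_iff
        del: One_nat_def)
qed

text \<open>The first sum collects the partitions without ones by their largest part m, the second
  one those with exactly j ones, where every part above j has weight -1.\<close>

lemma crank_sign_sum:
  assumes "n > 0"
  shows "(\<Sum>p\<in>partitions_of n. crank_sign p)
    = (\<Sum>m=2..n. (- 1) ^ m * (\<Prod>i=2..m. geom 1 i) $ (n - m))
    + (\<Sum>j=1..n. (- 1) ^ j * (\<Prod>i=2..n. geom (if j < i then - 1 else 1) i) $ (n - j))"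
proof -
  let ?P = "\<lambda>j. {p \<in> partitions_of n. num_ones p = j}"
  have "num_ones p \<le> n" if "p \<in> partitions_of n" for p
    using that partitions_with_ones[of "num_ones p" n] by (cases "num_ones p = 0") (auto split: if_splits)
  then have "partitions_of n = (\<Union>j\<in>{0..n}. ?P j)" by auto
  then have "(\<Sum>p\<in>partitions_of n. crank_sign p) = (\<Sum>j=0..n. \<Sum>p\<in>?P j. crank_sign p)"
    by (metis (no_types, lifting) sum.group[of "partitions_of n" "{0..n}" num_ones crank_sign]
        finite_partitions_of finite_atLeastAtMost image_subsetI atLeastAtMost_iff le0
        \<open>\<And>p. p \<in> partitions_of n \<Longrightarrow> num_ones p \<le> n\<close>)
  also have "\<dots> = (\<Sum>p\<in>?P 0. crank_sign p) + (\<Sum>j=1..n. \<Sum>p\<in>?P j. crank_sign p)"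
    by (simp add: sum.atLeast_Suc_atMost)
  also have "(\<Sum>p\<in>?P 0. crank_sign p)
    = (\<Sum>m=2..n. \<Sum>p\<in>add_mset m ` parts_in {2..m} (n - m). crank_sign p)"
    unfolding partitions_without_ones[OF assms]
  proof (rule sum.UNION_disjoint)
    show "\<forall>m\<in>{2..n}. \<forall>m'\<in>{2..n}. m \<noteq> m' \<longrightarrow>
      add_mset m ` parts_in {2..m} (n - m) \<inter> add_mset m' ` parts_in {2..m'} (n - m') = {}"
    proof (intro ballI impI, rule ccontr)
      fix m m' assume neq: "m \<noteq> m'"
        and "add_mset m ` parts_in {2..m} (n - m) \<inter> add_mset m' ` parts_in {2..m'} (n - m') \<noteq> {}"
      then obtain r r' where r: "r \<in> parts_in {2..m} (n - m)" "r' \<in> parts_in {2..m'} (n - m')"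
        and "add_mset m r = add_mset m' r'" by blast
      with neq have "m \<in># r'" "m' \<in># r"
        by (metis insert_noteq_member union_single_eq_member)+
      with r have "m \<le> m'" "m' \<le> m" by (auto simp: parts_in_def)
      with neq show False by simp
    qed
  qed (auto simp: finite_parts_in)
  also have "\<dots> = (\<Sum>m=2..n. (- 1) ^ m * (\<Prod>i=2..m. geom 1 i) $ (n - m))"
  proof (rule sum.cong)
    fix m assume m: "m \<in> {2..n}"
    have "(\<Sum>p\<in>add_mset m ` parts_in {2..m} (n - m). crank_sign p)
        = (\<Sum>r\<in>parts_in {2..m} (n - m). crank_sign (add_mset m r))"
      by (subst sum.reindex) (auto simp: inj_on_def)
    also have "\<dots> = (\<Sum>r\<in>parts_in {2..m} (n - m). (- 1) ^ m)"
      using m by (intro sum.cong) (auto simp: crank_sign_no_ones)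
    also have "\<dots> = (- 1) ^ m * (\<Prod>i=2..m. geom 1 i) $ (n - m)"
      using card_parts_in[of "{2..m}" "n - m"] by simp
    finally show "(\<Sum>p\<in>add_mset m ` parts_in {2..m} (n - m). crank_sign p)
      = (- 1) ^ m * (\<Prod>i=2..m. geom 1 i) $ (n - m)" .
  qed simp
  also have "(\<Sum>j=1..n. \<Sum>p\<in>?P j. crank_sign p)
    = (\<Sum>j=1..n. (- 1) ^ j * (\<Prod>i=2..n. geom (if j < i then - 1 else 1) i) $ (n - j))"
  proof (rule sum.cong)
    fix j assume j: "j \<in> {1..n}"
    then have "?P j = (\<lambda>r. replicate_mset j 1 + r) ` parts_in {2..n} (n - j)"
      using partitions_with_ones[of j n] by simp
    then have "(\<Sum>p\<in>?P j. crank_sign p)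
      = (\<Sum>r\<in>parts_in {2..n} (n - j). crank_sign (replicate_mset j 1 + r))"
      by (simp add: sum.reindex)
    also have "\<dots> = (\<Sum>r\<in>parts_in {2..n} (n - j). (- 1) ^ j * (\<Prod>x\<in>#r. if j < x then - 1 else 1))"
      using j by (intro sum.cong) (auto simp: crank_sign_ones simp del: One_nat_def)
    also have "\<dots> = (- 1) ^ j * (\<Prod>i=2..n. geom (if j < i then - 1 else 1) i) $ (n - j)"
      unfolding sum_distrib_left[symmetric] by (subst sum_parts_in) auto
    finally show "(\<Sum>p\<in>?P j. crank_sign p)
      = (- 1) ^ j * (\<Prod>i=2..n. geom (if j < i then - 1 else 1) i) $ (n - j)" .
  qed simp
  finally show ?thesis .
qed

section \<open>Truncated q-series identities\<close>

text \<open>Congruence modulo q^(N+1), by which finite sums and products stand for the infinite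
  ones.\<close>

definition agree :: "nat \<Rightarrow> int fps \<Rightarrow> int fps \<Rightarrow> bool" where
  "agree N F G \<longleftrightarrow> (\<forall>i\<le>N. F $ i = G $ i)"

lemma agree_refl [simp, intro]: "agree N F F"
  and agree_sym: "agree N F G \<Longrightarrow> agree N G F"
  and agree_trans [trans]: "agree N F G \<Longrightarrow> agree N G H \<Longrightarrow> agree N F H"
  by (auto simp: agree_def)

lemma agree_mult: "agree N F G \<Longrightarrow> agree N F' G' \<Longrightarrow> agree N (F * F') (G * G')"
  by (auto simp: agree_def fps_mult_nth intro!: sum.cong)

lemma agree_q_power_mult: "N < m \<Longrightarrow> agree N (G + q ^ m * F) G"
  by (simp add: agree_def fps_nth_q_power_mult)

lemma agree_1_minus_q_power: "N < m \<Longrightarrow> agree N (1 - q ^ m) 1"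
  using agree_q_power_mult[of N m 1 "- 1"] by simp

lemma agree_prod_1: "(\<And>i. i \<in> S \<Longrightarrow> agree N (F i) 1) \<Longrightarrow> agree N (\<Prod>i\<in>S. F i) 1"
proof (induction S rule: infinite_finite_induct)
  case (insert i S)
  then have "agree N (F i * (\<Prod>i\<in>S. F i)) (1 * 1)" by (intro agree_mult) auto
  with insert.hyps show ?case by simp
qed auto

lemma agree_prod_extend:
  assumes "\<And>i. N < i \<Longrightarrow> agree N (F i) 1" and "N \<le> K"
  shows "agree N (\<Prod>i=1..K. F i) (\<Prod>i=1..N. F i)"
proof -
  have "{1..K} = {1..N} \<union> {N<..K}" using assms(2) by auto
  then have "(\<Prod>i=1..K. F i) = (\<Prod>i=1..N. F i) * (\<Prod>i\<in>{N<..K}. F i)"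
    by (simp add: prod.union_disjoint[symmetric] del: prod.union_disjoint)
      (subst prod.union_disjoint, auto)
  moreover have "agree N ((\<Prod>i=1..N. F i) * (\<Prod>i\<in>{N<..K}. F i)) ((\<Prod>i=1..N. F i) * 1)"
    using assms(1) by (intro agree_mult agree_prod_1) auto
  ultimately show ?thesis by simp
qed

text \<open>The recurrence makes c_j play the role of (a;x)_j/(x;x)_j. The identity is the
  functional equation F(z)(1 - z) = F(xz)(1 - az) behind the q-binomial theorem; its last term is
  the error of truncating F.\<close>

lemma q_binomial_partial_sum:
  fixes c :: "nat \<Rightarrow> 'a :: comm_ring_1"
  assumes "c 0 = 1" and rec: "\<And>j. (1 - x ^ Suc j) * c (Suc j) = (1 - a * x ^ j) * c j"
  shows "(\<Sum>j\<le>N. c j * z ^ j) * (1 - z)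
    = (\<Sum>j\<le>N. c j * (x * z) ^ j) * (1 - a * z) - (1 - a * x ^ N) * c N * z ^ Suc N"
proof (induction N)
  case 0
  then show ?case using assms(1) by (simp add: algebra_simps)
next
  case (Suc N)
  have "(\<Sum>j\<le>Suc N. c j * z ^ j) * (1 - z)
    = (\<Sum>j\<le>N. c j * (x * z) ^ j) * (1 - a * z) - (1 - a * x ^ N) * c N * z ^ Suc N
      + c (Suc N) * z ^ Suc N * (1 - z)"
    by (simp only: sum.atMost_Suc distrib_right Suc.IH)
  also have "\<dots> = (\<Sum>j\<le>N. c j * (x * z) ^ j) * (1 - a * z)
      - (1 - x ^ Suc N) * c (Suc N) * z ^ Suc N + c (Suc N) * z ^ Suc N * (1 - z)"
    by (simp only: rec)
  also have "\<dots> = (\<Sum>j\<le>Suc N. c j * (x * z) ^ j) * (1 - a * z)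
      - (1 - a * x ^ Suc N) * c (Suc N) * z ^ Suc (Suc N)"
    by (simp add: algebra_simps power_mult_distrib)
  finally show ?case .
qed

text \<open>The functional equation is iterated along z = -q, -q^2, ..., -q^(N+1). At z = -q^k the
  truncation error is divisible by q^(k(N+1)), so it vanishes modulo q^(N+1), and at the last point
  only the constant term of the sum survives.\<close>

lemma q_binomial_minus_q:
  assumes "c 0 = 1" and rec: "\<And>j. (1 - q ^ Suc j) * c (Suc j) = (1 - a * q ^ j) * c j"
  shows "agree N ((\<Sum>j\<le>N. c j * (- q) ^ j) * (\<Prod>k=1..N. 1 + q ^ k)) (\<Prod>k=1..N. 1 + a * q ^ k)"
proof -
  define F where "F k = (\<Sum>j\<le>N. c j * (- (q ^ k)) ^ j)" for k
  have step: "agree N (F k * (1 + q ^ k)) (F (Suc k) * (1 + a * q ^ k))" if "k > 0" for k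
  proof -
    have "N < k * Suc N" using that by (cases k) auto
    have "F k * (1 + q ^ k) = F (Suc k) * (1 + a * q ^ k)
        + q ^ (k * Suc N) * (- (1 - a * q ^ N) * c N * (- 1) ^ Suc N)"
      using q_binomial_partial_sum[where c = c and x = q and a = a and z = "- (q ^ k)" and N = N,
          OF assms] unfolding F_def
      by (simp add: power_minus[of "q ^ k"] power_mult[symmetric] algebra_simps power_add)
    then show ?thesis using agree_q_power_mult[OF \<open>N < k * Suc N\<close>] by metis
  qed
  have "agree N (F 1 * (\<Prod>k=1..K. 1 + q ^ k)) (F (Suc K) * (\<Prod>k=1..K. 1 + a * q ^ k))" for K
  proof (induction K)
    case (Suc K)
    have "agree N (F 1 * (\<Prod>k=1..K. 1 + q ^ k) * (1 + q ^ Suc K))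
        (F (Suc K) * (\<Prod>k=1..K. 1 + a * q ^ k) * (1 + q ^ Suc K))"
      by (intro agree_mult Suc.IH agree_refl)
    also have "F (Suc K) * (\<Prod>k=1..K. 1 + a * q ^ k) * (1 + q ^ Suc K)
        = F (Suc K) * (1 + q ^ Suc K) * (\<Prod>k=1..K. 1 + a * q ^ k)"
      by (simp only: mult_ac)
    also have "agree N \<dots> (F (Suc (Suc K)) * (1 + a * q ^ Suc K) * (\<Prod>k=1..K. 1 + a * q ^ k))"
      by (intro agree_mult step agree_refl) simp
    finally show ?case by (simp only: prod.nat_ivl_Suc' mult_ac le_numeral_extra One_nat_def Suc_le_mono le0)
  qed simp
  moreover have "agree N (F (Suc N)) 1"
    unfolding agree_def
  proof (intro allI impI)
    fix i assume i: "i \<le> N"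
    have "(c j * (- (q ^ Suc N)) ^ j) $ i = 0" if "j \<in> {1..N}" for j
    proof -
      have "i < Suc N * j" using that i by (metis Suc_le_lessD Suc_leI atLeastAtMost_iff le_imp_less_Suc mult.commute mult_le_mono1 nat_mult_1 order_less_le_trans)
      have "c j * (- (q ^ Suc N)) ^ j = q ^ (Suc N * j) * ((- 1) ^ j * c j)"
        by (simp only: power_minus[of "q ^ Suc N"] power_mult) (simp only: mult_ac)
      then show ?thesis using \<open>i < Suc N * j\<close> by (simp only: fps_nth_q_power_mult) simp
    qed
    moreover have "{..N} = insert 0 {1..N}" by auto
    ultimately show "F (Suc N) $ i = 1 $ i"
      using assms(1) by (simp add: F_def fps_sum_nth)
  qed
  ultimately have "agree N (F 1 * (\<Prod>k=1..N. 1 + q ^ k)) (1 * (\<Prod>k=1..N. 1 + a * q ^ k))"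
    by (meson agree_mult agree_refl agree_trans)
  then show ?thesis by (simp add: F_def)
qed

section \<open>q-Pochhammer products and the signed generating function\<close>

definition qpoch :: "nat \<Rightarrow> int fps" where "qpoch n = (\<Prod>i=1..n. 1 - q ^ i)"
definition qpoch_plus :: "nat \<Rightarrow> int fps" where "qpoch_plus n = (\<Prod>i=1..n. 1 + q ^ i)"
definition inv_qpoch :: "nat \<Rightarrow> int fps" where "inv_qpoch n = (\<Prod>i=1..n. geom 1 i)"
definition inv_qpoch_plus :: "nat \<Rightarrow> int fps" where "inv_qpoch_plus n = (\<Prod>i=1..n. geom (- 1) i)"

lemma inv_qpoch_plus_cancel: "inv_qpoch_plus n * qpoch_plus n = 1"
  unfolding inv_qpoch_plus_def qpoch_plus_def prod.distrib[symmetric]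
  by (rule prod.neutral) (auto simp: geom_minus_1_cancel)

lemma prod_geom_from_2: "m \<ge> 1 \<Longrightarrow> (\<Prod>i=2..m. geom 1 i) = (1 - q) * inv_qpoch m"
proof -
  assume "m \<ge> 1"
  then have "inv_qpoch m = geom 1 1 * (\<Prod>i=2..m. geom 1 i)"
    unfolding inv_qpoch_def by (simp add: prod.atLeast_Suc_atMost numeral_2_eq_2)
  then have "(1 - q) * inv_qpoch m = (geom 1 1 * (1 - q ^ 1)) * (\<Prod>i=2..m. geom 1 i)"
    by (simp only: power_one_right mult_ac)
  then show ?thesis by (simp only: geom_1_cancel zero_less_one mult_1_left)
qed

text \<open>Completing the factors of the parts above j to \<open>inv_qpoch_plus n\<close> isolates
  the dependence on j as (-q;q)_j/(q;q)_j, the q-binomial coefficient with a = -q.\<close>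

lemma prod_geom_split:
  assumes "1 \<le> j" "j \<le> n"
  shows "(\<Prod>i=2..n. geom (if j < i then - 1 else 1) i)
    = (1 - q) * inv_qpoch_plus n * (inv_qpoch j * qpoch_plus j)"
proof -
  have "{2..n} = {2..j} \<union> {j<..n}" using assms by auto
  then have "(\<Prod>i=2..n. geom (if j < i then - 1 else 1) i)
      = (\<Prod>i=2..j. geom (if j < i then - 1 else 1) i) * (\<Prod>i\<in>{j<..n}. geom (if j < i then - 1 else 1) i)"
    by (simp only:) (subst prod.union_disjoint, auto)
  also have "\<dots> = (\<Prod>i=2..j. geom 1 i) * (\<Prod>i\<in>{j<..n}. geom (- 1) i)"
    by (intro arg_cong2[where f = "(*)"] prod.cong) auto
  finally have 1: "(\<Prod>i=2..n. geom (if j < i then - 1 else 1) i)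
      = (1 - q) * inv_qpoch j * (\<Prod>i\<in>{j<..n}. geom (- 1) i)"
    using prod_geom_from_2 assms by simp
  have "{1..n} = {1..j} \<union> {j<..n}" using assms by auto
  then have "inv_qpoch_plus n = inv_qpoch_plus j * (\<Prod>i\<in>{j<..n}. geom (- 1) i)"
    unfolding inv_qpoch_plus_def by (simp only:) (subst prod.union_disjoint, auto)
  then have "inv_qpoch_plus n * qpoch_plus j
      = (inv_qpoch_plus j * qpoch_plus j) * (\<Prod>i\<in>{j<..n}. geom (- 1) i)"
    by (simp only: mult_ac)
  then have "(\<Prod>i\<in>{j<..n}. geom (- 1) i) = inv_qpoch_plus n * qpoch_plus j"
    by (simp add: inv_qpoch_plus_cancel)
  with 1 show ?thesis by (simp only: mult_ac)
qed

text \<open>The q-binomial theorem with a = 0.\<close>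

lemma euler_sum: "agree N (\<Sum>j\<le>N. inv_qpoch j * (- q) ^ j) (inv_qpoch_plus N)"
proof -
  let ?F = "\<Sum>j\<le>N. inv_qpoch j * (- q) ^ j"
  have "(1 - q ^ Suc j) * inv_qpoch (Suc j) = inv_qpoch j" for j
  proof -
    have "(1 - q ^ Suc j) * inv_qpoch (Suc j) = inv_qpoch j * (geom 1 (Suc j) * (1 - q ^ Suc j))"
      by (simp add: inv_qpoch_def)
    then show ?thesis by (simp only: geom_1_cancel zero_less_Suc mult_1_right)
  qed
  then have "agree N (?F * qpoch_plus N) 1"
    using q_binomial_minus_q[where c = inv_qpoch and a = 0 and N = N]
    by (simp add: inv_qpoch_def qpoch_plus_def)
  then have "agree N (?F * qpoch_plus N * inv_qpoch_plus N) (1 * inv_qpoch_plus N)"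
    by (intro agree_mult agree_refl)
  also have "?F * qpoch_plus N * inv_qpoch_plus N = ?F * (inv_qpoch_plus N * qpoch_plus N)"
    by (simp only: mult_ac)
  finally show ?thesis by (simp add: inv_qpoch_plus_cancel)
qed

text \<open>The q-binomial theorem with a = -q. Its product side starts at 1 - q^2, so the factor 1
  - q completes \<open>qpoch\<close>; the surplus factor 1 - q^(N+1) is 1 modulo q^(N+1).\<close>

lemma cauchy_sum:
  "agree N ((1 - q) * (\<Sum>j\<le>N. inv_qpoch j * qpoch_plus j * (- q) ^ j)) (qpoch N * inv_qpoch_plus N)"
proof -
  let ?c = "\<lambda>j. inv_qpoch j * qpoch_plus j"
  let ?F = "\<Sum>j\<le>N. ?c j * (- q) ^ j"
  have "(1 - q ^ Suc j) * ?c (Suc j) = (1 - (- q) * q ^ j) * ?c j" for j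
  proof -
    have "(1 - q ^ Suc j) * ?c (Suc j)
        = (geom 1 (Suc j) * (1 - q ^ Suc j)) * (inv_qpoch j * (qpoch_plus j * (1 + q ^ Suc j)))"
      by (simp add: inv_qpoch_def qpoch_plus_def)
    then show ?thesis by (simp only: geom_1_cancel zero_less_Suc) (simp add: mult_ac)
  qed
  then have "agree N (?F * qpoch_plus N) (\<Prod>k=1..N. 1 + (- q) * q ^ k)"
    using q_binomial_minus_q[where c = ?c and a = "- q" and N = N]
    by (simp add: inv_qpoch_def qpoch_plus_def)
  then have "agree N ((1 - q) * inv_qpoch_plus N * (?F * qpoch_plus N))
      ((1 - q) * inv_qpoch_plus N * (\<Prod>k=1..N. 1 + (- q) * q ^ k))"
    by (intro agree_mult agree_refl)
  also have "(1 - q) * inv_qpoch_plus N * (?F * qpoch_plus N)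
      = (1 - q) * ?F * (inv_qpoch_plus N * qpoch_plus N)"
    by (simp only: mult_ac)
  also have "(1 - q) * inv_qpoch_plus N * (\<Prod>k=1..N. 1 + (- q) * q ^ k)
      = inv_qpoch_plus N * (\<Prod>k=1..Suc N. 1 - q ^ k)"
  proof -
    have "(\<Prod>k=1..Suc N. 1 - q ^ k) = (1 - q) * (\<Prod>k=1..N. 1 - q ^ Suc k)"
      by (simp add: prod.atLeast_Suc_atMost prod.atLeast_Suc_atMost_Suc_shift
          del: prod.cl_ivl_Suc)
    then show ?thesis by (simp add: mult_ac)
  qed
  also have "agree N \<dots> (inv_qpoch_plus N * qpoch N)"
    unfolding qpoch_def using agree_1_minus_q_power by (intro agree_mult agree_refl agree_prod_extend) auto
  finally show ?thesis by (simp add: inv_qpoch_plus_cancel mult_ac)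
qed

text \<open>With A = \<open>inv_qpoch_plus n\<close>, the two sums contribute (1 - q)A - (1 - q) + q
  and \<open>qpoch n\<close> A^2 - (1 - q)A at index n. The terms (1 - q)A cancel, and the remainder
  -1 + 2q is invisible from index 2 on.\<close>

lemma crank_sign_sum_eq_coeff:
  assumes "n \<ge> 2"
  shows "(\<Sum>p\<in>partitions_of n. crank_sign p) = (qpoch n * inv_qpoch_plus n * inv_qpoch_plus n) $ n"
proof -
  let ?A = "inv_qpoch_plus n"
  define F0 where "F0 = (\<Sum>j\<le>n. inv_qpoch j * (- q) ^ j)"
  define F1 where "F1 = (\<Sum>j\<le>n. inv_qpoch j * qpoch_plus j * (- q) ^ j)"
  have coeff: "(- 1) ^ m * F $ (n - m) = ((- q) ^ m * F) $ n" if "m \<le> n" for m and F :: "int fps"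
    using that by (cases "even m") (simp_all add: fps_nth_q_power_mult)
  have "(\<Sum>m=2..n. (- 1) ^ m * (\<Prod>i=2..m. geom 1 i) $ (n - m))
      = (\<Sum>m=2..n. ((1 - q) * (inv_qpoch m * (- q) ^ m)) $ n)"
    by (rule sum.cong) (auto simp: coeff prod_geom_from_2 mult_ac)
  also have "\<dots> = ((1 - q) * (\<Sum>m=2..n. inv_qpoch m * (- q) ^ m)) $ n"
    by (simp only: sum_distrib_left fps_sum_nth)
  also have "(\<Sum>m=2..n. inv_qpoch m * (- q) ^ m) = F0 - 1 + q * geom 1 1"
  proof -
    \<comment> \<open>The sum over m starts at 2, so the terms 1 and -q/(1 - q) of \<open>F0\<close>
      are taken out.\<close>
    have "{..n} = {0, 1} \<union> {2..n}" using assms by auto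
    then show ?thesis by (simp add: F0_def inv_qpoch_def)
  qed
  also have "(1 - q) * (F0 - 1 + q * geom 1 1) = (1 - q) * F0 - (1 - q) + q * (geom 1 1 * (1 - q ^ 1))"
    by (simp add: algebra_simps)
  finally have 1: "(\<Sum>m=2..n. (- 1) ^ m * (\<Prod>i=2..m. geom 1 i) $ (n - m))
      = ((1 - q) * F0 - (1 - q) + q) $ n"
    by (simp only: geom_1_cancel zero_less_one mult_1_right)
  have "(\<Sum>j=1..n. (- 1) ^ j * (\<Prod>i=2..n. geom (if j < i then - 1 else 1) i) $ (n - j))
      = (\<Sum>j=1..n. ((1 - q) * ?A * (inv_qpoch j * qpoch_plus j * (- q) ^ j)) $ n)"
    by (rule sum.cong) (auto simp: coeff prod_geom_split mult_ac)
  also have "\<dots> = ((1 - q) * ?A * (\<Sum>j=1..n. inv_qpoch j * qpoch_plus j * (- q) ^ j)) $ n"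
    by (simp only: sum_distrib_left fps_sum_nth)
  also have "(\<Sum>j=1..n. inv_qpoch j * qpoch_plus j * (- q) ^ j) = F1 - 1"
  proof -
    have "{..n} = insert 0 {1..n}" by auto
    then show ?thesis by (simp add: F1_def inv_qpoch_def qpoch_plus_def)
  qed
  also have "(1 - q) * ?A * (F1 - 1) = (1 - q) * F1 * ?A - (1 - q) * ?A"
    by (simp add: algebra_simps)
  finally have 2: "(\<Sum>j=1..n. (- 1) ^ j * (\<Prod>i=2..n. geom (if j < i then - 1 else 1) i) $ (n - j))
      = ((1 - q) * F1 * ?A - (1 - q) * ?A) $ n" .
  have "agree n ((1 - q) * F0) ((1 - q) * ?A)"
    unfolding F0_def by (intro agree_mult euler_sum agree_refl)
  moreover have "agree n ((1 - q) * F1 * ?A) (qpoch n * ?A * ?A)"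
    unfolding F1_def by (intro agree_mult cauchy_sum agree_refl)
  ultimately have "((1 - q) * F0) $ n = ((1 - q) * ?A) $ n"
    and "((1 - q) * F1 * ?A) $ n = (qpoch n * ?A * ?A) $ n"
    by (simp_all add: agree_def)
  then show ?thesis
    using crank_sign_sum[of n] assms unfolding 1 2 fps_add_nth fps_sub_nth
    by (simp add: fps_X_nth)
qed

text \<open>A finite form, due to Shanks, of Gauss' identity: the term with index s is divisible by
  q^(s(n+1)), so modulo q^(n+1) only the product with s = 0 survives. The difference of two
  consecutive left-hand sides telescopes in s.\<close>

lemma shanks_partial_sum:
  fixes n :: nat
  defines "g \<equiv> \<lambda>i. (1 - q ^ i) * geom (- 1) i"
    and "h \<equiv> \<lambda>s. if s = 0 then 1 else 2 * geom (- 1) s"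
  shows "(\<Sum>s\<le>n. (- 1) ^ s * (\<Prod>i=Suc s..n. g i) * q ^ (s * Suc n) * h s)
    = 1 + 2 * (\<Sum>s=1..n. (- 1) ^ s * q ^ s\<^sup>2)"
proof -
  define t where "t n s = (- 1) ^ s * (\<Prod>i=Suc s..n. g i) * q ^ (s * Suc n) * h s" for n s
  have key: "h (Suc k) * (g (Suc m) * q ^ Suc k - 1) = - h (Suc m) * (q ^ Suc m + g (Suc k))" for k m
  proof -
    define x where "x = q ^ Suc k"
    define y where "y = q ^ Suc m"
    define G where "G = geom (- 1) (Suc k)"
    define H where "H = geom (- 1) (Suc m)"
    have G: "G * (1 + x) = 1" and H: "H * (1 + y) = 1"
      unfolding G_def H_def x_def y_def by (simp_all only: geom_minus_1_cancel zero_less_Suc)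
    \<comment> \<open>Writing 1 as \<open>H * (1 + y)\<close> makes both sides comparable as
      polynomials in x, y, G and H.\<close>
    have "2 * G * ((1 - y) * H * x - 1) = 2 * G * ((1 - y) * H * x - H * (1 + y))"
      unfolding H by simp
    also have "\<dots> = - (2 * H) * (y * (G * (1 + x)) + (1 - x) * G)"
      by (simp add: algebra_simps)
    finally have "2 * G * ((1 - y) * H * x - 1) = - (2 * H) * (y + (1 - x) * G)"
      unfolding G by simp
    then show ?thesis
      unfolding h_def g_def by (simp only: nat.distinct if_False x_def y_def G_def H_def)
  qed
  have g_minus_1: "g (Suc m) - 1 = - h (Suc m) * q ^ Suc m" for m
  proof -
    have "g (Suc m) - 1 = (1 - q ^ Suc m) * geom (- 1) (Suc m) - geom (- 1) (Suc m) * (1 + q ^ Suc m)"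
      unfolding g_def by (simp only: geom_minus_1_cancel zero_less_Suc)
    then show ?thesis by (simp add: h_def algebra_simps)
  qed
  \<comment> \<open>Closed form of the telescoping sum. For k = m the product is empty, and adding
    the new term with index m + 1 turns \<open>h (Suc m)\<close> into
    \<open>h (Suc m) * (1 + q ^ Suc m)\<close>, which is 2; what remains is 2 (-1)^(m+1)
    q^((m+1)^2).\<close>
  have tele: "(\<Sum>s\<le>k. t (Suc m) s - t m s)
      = (- 1) ^ Suc k * h (Suc m) * (\<Prod>i=Suc k..m. g i) * q ^ (Suc k * Suc m)" if "k \<le> m" for k m
    using that
  proof (induction k)
    case 0
    have "t (Suc m) 0 - t m 0 = (\<Prod>i=1..m. g i) * (g (Suc m) - 1)"
      by (simp add: t_def h_def algebra_simps)
    then show ?case unfolding g_minus_1 by (simp add: algebra_simps)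
  next
    case (Suc k)
    define P where "P = (\<Prod>i=Suc (Suc k)..m. g i)"
    have P1: "(\<Prod>i=Suc k..m. g i) = g (Suc k) * P"
      unfolding P_def using Suc.prems by (simp add: prod.atLeast_Suc_atMost)
    have P2: "(\<Prod>i=Suc (Suc k)..Suc m. g i) = P * g (Suc m)"
      unfolding P_def using Suc.prems by (simp add: mult.commute)
    let ?e = "(- 1) ^ Suc k * P * q ^ (Suc k * Suc m)"
    have "t (Suc m) (Suc k) - t m (Suc k) = ?e * (h (Suc k) * (g (Suc m) * q ^ Suc k - 1))"
      unfolding t_def P2 P_def[symmetric] mult_Suc_right[of "Suc k" "Suc m"] power_add
      by (simp only: right_diff_distrib mult_1_right) (simp only: mult_ac)
    also have "\<dots> = - ?e * h (Suc m) * (q ^ Suc m + g (Suc k))"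
      unfolding key by (simp only: mult_minus_left mult_minus_right mult_ac)
    finally have *: "t (Suc m) (Suc k) - t m (Suc k) = - ?e * h (Suc m) * (q ^ Suc m + g (Suc k))" .
    have "(\<Sum>s\<le>Suc k. t (Suc m) s - t m s)
        = (- 1) ^ Suc k * h (Suc m) * (g (Suc k) * P) * q ^ (Suc k * Suc m)
          - ?e * h (Suc m) * (q ^ Suc m + g (Suc k))"
      using Suc.IH Suc.prems unfolding sum.atMost_Suc * P1 by simp
    also have "\<dots> = (- 1) ^ Suc (Suc k) * h (Suc m) * P * (q ^ Suc m * q ^ (Suc k * Suc m))"
      by (simp add: algebra_simps)
    finally show ?case unfolding P_def by (simp only: mult_Suc power_add)
  qed
  have "(\<Sum>s\<le>n. t n s) = 1 + 2 * (\<Sum>s=1..n. (- 1) ^ s * q ^ s\<^sup>2)"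
  proof (induction n)
    case 0
    then show ?case by (simp add: t_def h_def)
  next
    case (Suc m)
    have "h (Suc m) * (1 + q ^ Suc m) = 2 * (geom (- 1) (Suc m) * (1 + q ^ Suc m))"
      by (simp add: h_def)
    then have "h (Suc m) * (1 + q ^ Suc m) = 2"
      by (simp only: geom_minus_1_cancel zero_less_Suc mult_1_right)
    then have hm: "h (Suc m) + h (Suc m) * q ^ Suc m = 2"
      by (simp only: distrib_left mult_1_right)
    have "(\<Sum>s\<le>Suc m. t (Suc m) s)
        = (\<Sum>s\<le>m. t m s) + ((\<Sum>s\<le>m. t (Suc m) s - t m s) + t (Suc m) (Suc m))"
      by (simp add: sum_subtractf)
    also have "(\<Sum>s\<le>m. t (Suc m) s - t m s) + t (Suc m) (Suc m)
        = (- 1) ^ Suc m * q ^ (Suc m * Suc m) * (h (Suc m) + h (Suc m) * q ^ Suc m)"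
      unfolding tele[OF order_refl]
      unfolding t_def mult_Suc_right[of "Suc m" "Suc m"] power_add
      by (simp add: algebra_simps)
    finally show ?case using Suc.IH unfolding hm by (simp add: power2_eq_square algebra_simps)
  qed
  then show ?thesis unfolding t_def .
qed

lemma gauss_theta:
  "agree n (qpoch n * inv_qpoch_plus n) (1 + 2 * (\<Sum>s=1..n. (- 1) ^ s * q ^ s\<^sup>2))"
proof -
  let ?t = "\<lambda>s. (- 1) ^ s * (\<Prod>i=Suc s..n. (1 - q ^ i) * geom (- 1) i) * q ^ (s * Suc n)
      * (if s = 0 then 1 else 2 * geom (- 1) s)"
  have "qpoch n * inv_qpoch_plus n = ?t 0"
    by (simp add: qpoch_def inv_qpoch_plus_def prod.distrib)
  moreover have "(\<Sum>s\<le>n. ?t s) = ?t 0 + (\<Sum>s=1..n. ?t s)"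
    by (simp only: atMost_atLeast0 sum.atLeast_Suc_atMost[OF le0] One_nat_def)
  moreover have "agree n (?t 0 + (\<Sum>s=1..n. ?t s)) (?t 0)"
  proof -
    have "?t s $ i = 0" if "s \<in> {1..n}" "i \<le> n" for s i
    proof -
      have "i < s * Suc n" using that by (cases s) auto
      moreover have "?t s = q ^ (s * Suc n) * ((- 1) ^ s
          * (\<Prod>i=Suc s..n. (1 - q ^ i) * geom (- 1) i) * (if s = 0 then 1 else 2 * geom (- 1) s))"
        by (simp only: mult_ac)
      ultimately show ?thesis by (simp only: fps_nth_q_power_mult) simp
    qed
    then show ?thesis by (simp add: agree_def fps_sum_nth del: mult_Suc_right)
  qed
  ultimately have "agree n (\<Sum>s\<le>n. ?t s) (qpoch n * inv_qpoch_plus n)" by simp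
  then show ?thesis unfolding shanks_partial_sum by (rule agree_sym)
qed

text \<open>The finite identity (-q;q)_n (q;q^2)_n = product of 1 - q^i over n < i <= 2n has a
  right-hand side that is 1 modulo q^(n+1).\<close>

lemma euler_odd_distinct: "agree n (inv_qpoch_plus n) (\<Prod>i=1..n. 1 - q ^ (2 * i - 1))"
proof -
  let ?O = "\<lambda>n. \<Prod>i=1..n. 1 - q ^ (2 * i - 1)"
  have "qpoch_plus n * ?O n = (\<Prod>i=Suc n..2 * n. 1 - q ^ i)"
  proof (induction n)
    case (Suc n)
    have sq: "(1 + q ^ Suc n) * (1 - q ^ Suc n) = 1 - q ^ (2 * Suc n)"
      by (simp add: algebra_simps mult_2 mult_2_right power_add)
    \<comment> \<open>When n grows, 1 - q^(n+1) leaves the range of the product and merges with the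
      new factor 1 + q^(n+1). Splitting it off needs a nonempty range, hence the separate case n =
      0.\<close>
    show ?case
    proof (cases "n = 0")
      case True
      then show ?thesis by (simp add: qpoch_plus_def algebra_simps)
    next
      case False
      define P where "P = (\<Prod>i=Suc (Suc n)..2 * n. 1 - q ^ i)"
      have "qpoch_plus (Suc n) * ?O (Suc n)
          = (qpoch_plus n * ?O n) * (1 + q ^ Suc n) * (1 - q ^ Suc (2 * n))"
        by (simp add: qpoch_plus_def mult_ac)
      also have "qpoch_plus n * ?O n = (1 - q ^ Suc n) * P"
        unfolding Suc.IH P_def using False by (simp add: prod.atLeast_Suc_atMost)
      also have "(1 - q ^ Suc n) * P * (1 + q ^ Suc n) * (1 - q ^ Suc (2 * n))
          = P * (1 - q ^ Suc (2 * n)) * ((1 + q ^ Suc n) * (1 - q ^ Suc n))"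
        by (simp only: mult_ac)
      also have "\<dots> = (\<Prod>i=Suc (Suc n)..Suc (Suc (2 * n)). 1 - q ^ i)"
        unfolding sq P_def using False by (simp add: mult_ac)
      finally show ?thesis by simp
    qed
  qed (simp add: qpoch_plus_def)
  moreover have "agree n (\<Prod>i=Suc n..2 * n. 1 - q ^ i) 1"
    by (intro agree_prod_1 agree_1_minus_q_power) auto
  ultimately have "agree n (inv_qpoch_plus n * (qpoch_plus n * ?O n)) (inv_qpoch_plus n * 1)"
    by (metis agree_mult agree_refl)
  then have "agree n ((inv_qpoch_plus n * qpoch_plus n) * ?O n) (inv_qpoch_plus n)"
    by (simp only: mult_ac mult_1_right mult_1_left)
  then show ?thesis unfolding inv_qpoch_plus_cancel by (simp add: agree_sym)
qed

text \<open>The truncation order N does not depend on n, so one fixed series supplies the three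
  consecutive values of a second difference.\<close>

lemma M_diff_eq_coeff:
  assumes "2 \<le> n" "n \<le> N"
  shows "int (M 0 n) - int (M 1 n)
    = ((1 + 2 * (\<Sum>s=1..N. (- 1) ^ s * q ^ s\<^sup>2)) * (\<Prod>i=1..N. 1 - q ^ (2 * i - 1))) $ n"
proof -
  have "agree n (qpoch n * inv_qpoch_plus n * inv_qpoch_plus n)
      (qpoch N * inv_qpoch_plus N * inv_qpoch_plus N)"
  proof (intro agree_mult)
    show "agree n (qpoch n) (qpoch N)"
      unfolding qpoch_def using assms by (intro agree_sym[OF agree_prod_extend] agree_1_minus_q_power)
    have "agree n (geom (- 1) i) 1" if "n < i" for i
      using that by (auto simp: agree_def geom_def dest: dvd_imp_le)
    then show "agree n (inv_qpoch_plus n) (inv_qpoch_plus N)"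
      unfolding inv_qpoch_plus_def using assms by (intro agree_sym[OF agree_prod_extend])
    then show "agree n (inv_qpoch_plus n) (inv_qpoch_plus N)" .
  qed
  moreover have "agree N (qpoch N * inv_qpoch_plus N * inv_qpoch_plus N)
      ((1 + 2 * (\<Sum>s=1..N. (- 1) ^ s * q ^ s\<^sup>2)) * (\<Prod>i=1..N. 1 - q ^ (2 * i - 1)))"
    by (intro agree_mult gauss_theta euler_odd_distinct)
  ultimately show ?thesis
    using assms unfolding M_diff crank_sign_sum_eq_coeff[OF assms(1)] agree_def by simp
qed

lemma card_partitions_eq_coeff:
  assumes "n \<le> N"
  shows "int (card (partitions_of n)) = inv_qpoch N $ n"
proof -
  have "agree n (inv_qpoch N) (inv_qpoch n)"
    unfolding inv_qpoch_def using assms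
    by (intro agree_prod_extend) (auto simp: agree_def geom_def dest: dvd_imp_le)
  then show ?thesis
    by (simp add: partitions_of_eq_parts_in card_parts_in agree_def inv_qpoch_def)
qed

section \<open>Majorants for the second differences\<close>

definition dominated :: "int fps \<Rightarrow> int fps \<Rightarrow> bool" where
  "dominated F G \<longleftrightarrow> (\<forall>n. \<bar>F $ n\<bar> \<le> G $ n)"

lemma dominated_mult:
  assumes "dominated F G" "dominated F' G'"
  shows "dominated (F * F') (G * G')"
  unfolding dominated_def
proof
  fix n
  have "\<bar>(F * F') $ n\<bar> \<le> (\<Sum>i=0..n. \<bar>F $ i * F' $ (n - i)\<bar>)"
    unfolding fps_mult_nth by (rule sum_abs)
  also have "\<dots> \<le> (\<Sum>i=0..n. G $ i * G' $ (n - i))"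
    unfolding abs_mult using assms
    by (intro sum_mono mult_mono) (auto simp: dominated_def intro: order_trans[OF abs_ge_zero])
  finally show "\<bar>(F * F') $ n\<bar> \<le> (G * G') $ n" by (simp add: fps_mult_nth)
qed

lemma dominated_1_minus_q_power: "m > 0 \<Longrightarrow> dominated (1 - q ^ m) (1 + q ^ m)"
  by (simp add: dominated_def fps_X_power_nth)

lemma dominated_prod:
  "(\<And>i. i \<in> S \<Longrightarrow> dominated (F i) (G i)) \<Longrightarrow> dominated (\<Prod>i\<in>S. F i) (\<Prod>i\<in>S. G i)"
proof (induction S rule: infinite_finite_induct)
  case (insert i S)
  then show ?case by (simp add: dominated_mult)
qed (simp_all add: dominated_def)

text \<open>The sum of q^(s^2) over all integers s; the 2 counts s and -s.\<close>

definition theta :: "int fps" where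
  "theta = Abs_fps (\<lambda>n. if n = 0 then 1 else if \<exists>s\<in>{0..n}. s * s = n then 2 else 0)"

text \<open>At most one \<open>s >= 1\<close> has a given square, so no coefficient collects two
  terms.\<close>

lemma dominated_theta: "dominated (1 + 2 * (\<Sum>s=1..N. (- 1) ^ s * q ^ s\<^sup>2)) theta"
  unfolding dominated_def
proof
  fix n
  have coeff: "((- 1) ^ s * q ^ s\<^sup>2) $ n = (if n = s\<^sup>2 then (- 1) ^ s else 0)" for s
    by (cases "even s") (auto simp: fps_X_power_nth)
  define S where "S = (\<Sum>s=1..N. if n = s\<^sup>2 then (- 1) ^ s else (0::int))"
  have "(1 + 2 * (\<Sum>s=1..N. (- 1) ^ s * q ^ s\<^sup>2)) $ n = (if n = 0 then 1 else 0) + 2 * S"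
    unfolding S_def by (simp add: fps_sum_nth coeff numeral_fps_const)
  moreover have "\<bar>S\<bar> \<le> (if n \<noteq> 0 \<and> (\<exists>s\<in>{0..n}. s * s = n) then 1 else 0)"
  proof (cases "n \<noteq> 0 \<and> (\<exists>s\<in>{0..n}. s * s = n)")
    case True
    then obtain t where t: "n = t\<^sup>2" by (auto simp: power2_eq_square)
    then have "S = (\<Sum>s=1..N. if s = t then (- 1) ^ s else 0)"
      unfolding S_def by (intro sum.cong) auto
    then show ?thesis using True by simp
  next
    case False
    have "n \<noteq> s\<^sup>2" if "s \<in> {1..N}" for s
    proof
      assume n: "n = s\<^sup>2"
      with that have "n \<noteq> 0" "s * s = n" "s \<in> {0..n}" by (auto simp: power2_eq_square)
      with False show False by blast
    qed
    then have "S = 0" unfolding S_def by (intro sum.neutral) auto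
    then show ?thesis using False by simp
  qed
  moreover have "theta $ n = (if n = 0 then 1 else if \<exists>s\<in>{0..n}. s * s = n then 2 else 0)"
    by (simp add: theta_def)
  ultimately show "\<bar>(1 + 2 * (\<Sum>s=1..N. (- 1) ^ s * q ^ s\<^sup>2)) $ n\<bar> \<le> theta $ n"
    by (smt (verit))
qed

text \<open>For \<open>K >= 1\<close> this is (1 - q)^2/(q;q)_K with one factor 1 - q
  cancelled.\<close>

definition part_diff :: "nat \<Rightarrow> int fps" where
  "part_diff K = (1 - q) * (\<Prod>i=2..K. geom 1 i)"

text \<open>The product (1 + q)^2 \<open>theta\<close> (-q;q^2) restricted to odd exponents up to K.
  Steps to an even index change nothing, which keeps the index parallel to that of
  \<open>part_diff\<close>.\<close>

primrec crank_bound :: "nat \<Rightarrow> int fps" where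
  "crank_bound 0 = (1 + q) ^ 2 * theta"
| "crank_bound (Suc K) = (if even K then (1 + q ^ Suc K) * crank_bound K else crank_bound K)"

lemma part_diff_Suc: "K \<ge> 1 \<Longrightarrow> part_diff (Suc K) = part_diff K * geom 1 (Suc K)"
  by (simp add: part_diff_def mult.assoc mult.left_commute)

lemma part_diff_Suc_nth:
  "K \<ge> 1 \<Longrightarrow> part_diff (Suc K) $ n
    = part_diff K $ n + (if Suc K \<le> n then part_diff (Suc K) $ (n - Suc K) else 0)"
  using nth_mult_geom[of "Suc K" "part_diff K" 1 n] by (simp add: part_diff_Suc)

lemma nth_1_plus_q_power_mult: "((1 + q ^ m) * F) $ n = F $ n + (if m \<le> n then F $ (n - m) else 0)"
  using fps_nth_q_power_mult[of m F n] by (simp add: distrib_right)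

lemma crank_bound_Suc_nth:
  "crank_bound (Suc K) $ n
    = crank_bound K $ n + (if even K \<and> Suc K \<le> n then crank_bound K $ (n - Suc K) else 0)"
  using nth_1_plus_q_power_mult[of "Suc K" "crank_bound K" n] by simp

text \<open>The coefficients of \<open>theta\<close> are at most 2, and every factor 1 + q^m at most
  doubles the bound: twice for (1 + q)^2 and once for each odd exponent up to K.\<close>

lemma crank_bound_bounds:
  "0 \<le> crank_bound K $ n" "crank_bound K $ n \<le> 8 * 2 ^ (Suc K div 2)"
proof -
  have "0 \<le> crank_bound K $ n \<and> crank_bound K $ n \<le> 8 * 2 ^ (Suc K div 2)" for n
  proof (induction K arbitrary: n)
    case 0
    have th: "0 \<le> theta $ n" "theta $ n \<le> 2" for n by (auto simp: theta_def)
    have "crank_bound 0 = (1 + q ^ 1) * ((1 + q ^ 1) * theta)"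
      by (simp add: power2_eq_square mult.assoc)
    moreover have "((1 + q ^ 1) * ((1 + q ^ 1) * theta)) $ n \<le> 8"
      unfolding nth_1_plus_q_power_mult using th[of n] th[of "n - 1"] th[of "n - 1 - 1"] th[of 0] by simp
    moreover have "((1 + q ^ 1) * ((1 + q ^ 1) * theta)) $ n \<ge> 0"
      unfolding nth_1_plus_q_power_mult using th by simp
    ultimately show ?case by (simp del: crank_bound.simps)
  next
    case (Suc K)
    have "(8::int) * 2 ^ (Suc K div 2) \<le> 8 * 2 ^ (Suc (Suc K) div 2)"
      by (intro mult_left_mono power_increasing div_le_mono) auto
    then show ?case
      using Suc.IH[of n] Suc.IH[of "n - Suc K"] unfolding crank_bound_Suc_nth
      by (cases "even K") auto
  qed
  then show "0 \<le> crank_bound K $ n" "crank_bound K $ n \<le> 8 * 2 ^ (Suc K div 2)" by auto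
qed

lemma crank_bound_mono: "crank_bound K $ n \<le> crank_bound (Suc K) $ n"
  using crank_bound_bounds(1) unfolding crank_bound_Suc_nth by simp

definition gap :: "nat \<Rightarrow> nat \<Rightarrow> int" where
  "gap K n = part_diff K $ n - crank_bound K $ n"

text \<open>At n, \<open>part_diff\<close> gains its new coefficient at n - K - 1, whereas
  \<open>crank_bound\<close> gains at most its old one there, which is no larger than the new
  one.\<close>

lemma gap_Suc_ge:
  assumes "K \<ge> 1"
  shows "gap K n + (if Suc K \<le> n then gap (Suc K) (n - Suc K) else 0) \<le> gap (Suc K) n"
  using crank_bound_mono[of K "n - Suc K"] crank_bound_bounds(1)[of "Suc K" "n - Suc K"]
  unfolding gap_def part_diff_Suc_nth[OF assms, of n] crank_bound_Suc_nth[of K n] by auto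

lemma gap_Suc_eq: "K \<ge> 1 \<Longrightarrow> n \<le> K \<Longrightarrow> gap (Suc K) n = gap K n"
  unfolding gap_def part_diff_Suc_nth[of K n] crank_bound_Suc_nth[of K n] by simp

section \<open>Verified computation of coefficients\<close>

definition prefix_of :: "int list \<Rightarrow> int fps \<Rightarrow> bool" where
  "prefix_of xs F \<longleftrightarrow> (\<forall>i<length xs. xs ! i = F $ i)"

text \<open>Multiplication by 1 + q^m; the zip inside \<open>map2\<close> cuts the shifted list back
  to the length of \<open>xs\<close>.\<close>

definition shift_add :: "nat \<Rightarrow> int list \<Rightarrow> int list" where
  "shift_add m xs = map2 (+) xs (replicate m 0 @ xs)"

text \<open>Uses 1/(1 - q^m) = (1 + q^m)(1 + q^(2m))(1 + q^(4m))..., where factors with exponents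
  beyond the list have no effect. The test \<open>m = 0\<close> secures termination.\<close>

function mult_geom :: "nat \<Rightarrow> int list \<Rightarrow> int list" where
  "mult_geom m xs = (if m = 0 \<or> length xs \<le> m then xs else mult_geom (2 * m) (shift_add m xs))"
  by auto

lemma length_shift_add [simp]: "length (shift_add m xs) = length xs"
  by (simp add: shift_add_def)

termination by (relation "measure (\<lambda>(m, xs). length xs - m)") auto

declare mult_geom.simps [simp del]

lemma prefix_of_shift_add: "prefix_of xs F \<Longrightarrow> prefix_of (shift_add m xs) ((1 + q ^ m) * F)"
  unfolding prefix_of_def nth_1_plus_q_power_mult
  by (auto simp: shift_add_def nth_append)

lemma length_mult_geom [simp]: "length (mult_geom m xs) = length xs"
  by (induction m xs rule: mult_geom.induct) (subst mult_geom.simps, simp)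

lemma geom_double: "m > 0 \<Longrightarrow> geom 1 m = (1 + q ^ m) * geom 1 (2 * m)"
proof -
  assume m: "m > 0"
  have "(1 + q ^ m) * (1 - q ^ m) = 1 - q ^ (2 * m)"
    by (simp add: algebra_simps mult_2 mult_2_right power_add)
  then have "(1 + q ^ m) * geom 1 (2 * m) * (1 - q ^ m) = geom 1 (2 * m) * (1 - q ^ (2 * m))"
    by (metis mult.assoc mult.commute)
  also have "\<dots> = 1" using m by (simp add: geom_1_cancel del: mult_2)
  finally have "geom 1 m * ((1 + q ^ m) * geom 1 (2 * m) * (1 - q ^ m)) = geom 1 m" by simp
  then have "(geom 1 m * (1 - q ^ m)) * ((1 + q ^ m) * geom 1 (2 * m)) = geom 1 m"
    by (simp only: mult_ac)
  then show ?thesis using geom_1_cancel[OF m] by simp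
qed

lemma prefix_of_mult_geom:
  assumes "m > 0" "prefix_of xs F"
  shows "prefix_of (mult_geom m xs) (F * geom 1 m)"
  using assms
proof (induction m xs arbitrary: F rule: mult_geom.induct)
  case (1 m xs)
  show ?case
  proof (cases "length xs \<le> m")
    case True
    then show ?thesis using 1(2,3) nth_mult_geom[of m F 1]
      by (subst mult_geom.simps) (auto simp: prefix_of_def)
  next
    case False
    then have "prefix_of (mult_geom (2 * m) (shift_add m xs)) ((1 + q ^ m) * F * geom 1 (2 * m))"
      using 1 by (intro "1.IH" prefix_of_shift_add) auto
    moreover have "(1 + q ^ m) * F * geom 1 (2 * m) = F * geom 1 m"
      using geom_double[of m] 1 by (simp add: mult_ac)
    ultimately show ?thesis using False 1 by (subst mult_geom.simps) auto
  qed
qed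

definition start_diff :: "int list" where
  "start_diff = 1 # - 1 # replicate 85 0"

text \<open>The inner list holds \<open>theta\<close>; two shifts give (1 + q)^2 and the third is
  the factor with odd exponent 1.\<close>

definition start_bound :: "int list" where
  "start_bound = shift_add 1 (shift_add 1 (shift_add 1
     (map (\<lambda>n. if n = 0 then 1
        else if n \<in> set [1, 4, 9, 16, 25, 36, 49, 64, 81] then 2 else 0) [0..<87])))"

text \<open>The constant 12513 is 1 + 300 * 40 + 8 * 2^6: the reserve needed in \<open>gap_large\<close> plus the
  bound on \<open>crank_bound 12\<close>. The list length 87 = 75 + 12 leaves room for a full
  period of 12 indices from 75 on.\<close>

definition checks :: "nat \<Rightarrow> int list \<Rightarrow> int list \<Rightarrow> bool" where
  "checks K r d \<longleftrightarrow>
    (5 \<le> K \<and> K < 12 \<longrightarrow> list_all (\<lambda>x. 0 \<le> x) (drop 30 r)) \<and>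
    (K = 12 \<longrightarrow> list_all (\<lambda>x. 12513 \<le> x) (drop 75 r)) \<and>
    (12 \<le> K \<longrightarrow> list_all (\<lambda>x. - 300 \<le> x) (take 40 (map2 (-) r d)) \<and>
                list_all (\<lambda>x. 1 \<le> x) (drop 40 (take 75 (map2 (-) r d))))"

fun check_run :: "nat \<Rightarrow> nat \<Rightarrow> int list \<Rightarrow> int list \<Rightarrow> bool" where
  "check_run 0 K r d = True"
| "check_run (Suc f) K r d =
    (let r' = mult_geom (Suc K) r; d' = (if even K then shift_add (Suc K) d else d)
     in checks (Suc K) r' d' \<and> check_run f (Suc K) r' d')"

text \<open>Provides the initial period for the induction in \<open>diff_235_nonneg\<close>.\<close>

lemma check_235: "list_all (\<lambda>x. 0 \<le> x) (drop 30 (mult_geom 5 (mult_geom 3 (mult_geom 2 start_diff))))"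
  by code_simp

text \<open>74 steps lead from K = 1 to K = 75, where the coefficients below index 75 have become
  stable.\<close>

lemma check_run_start: "check_run 74 1 start_diff start_bound"
  by code_simp

lemma length_start [simp]: "length start_diff = 87" "length start_bound = 87"
  by (simp_all add: start_diff_def start_bound_def)

lemma prefix_of_start_diff: "prefix_of start_diff (part_diff 1)"
  by (auto simp: prefix_of_def start_diff_def part_diff_def nth_Cons split: nat.splits)

lemma prefix_of_start_bound: "prefix_of start_bound (crank_bound 1)"
proof -
  let ?xs = "map (\<lambda>n. if n = 0 then 1
    else if n \<in> set [1, 4, 9, 16, 25, 36, 49, 64, 81] then 2 else 0 :: int) [0..<87]"
  have "prefix_of ?xs theta"
    unfolding prefix_of_def
  proof (intro allI impI)
    fix n assume "n < length ?xs"
    then have n: "n < 87" by simp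
    have "s < 10" if "s * s = n" for s
    proof (rule ccontr)
      assume "\<not> s < 10"
      then have "10 * 10 \<le> s * s" by (intro mult_le_mono) auto
      with that n show False by simp
    qed
    then have "(\<exists>s\<in>{0..n}. s * s = n) \<longleftrightarrow> (\<exists>s\<in>{0..<10}. s * s = n)" by force
    moreover have "{0..<10} = {0, 1, 2, 3, 4, 5, 6, 7, 8, 9::nat}" by auto
    ultimately have "(\<exists>s\<in>{0..n}. s * s = n) \<longleftrightarrow> n \<in> set [0, 1, 4, 9, 16, 25, 36, 49, 64, 81]"
      by auto
    with n show "?xs ! n = theta $ n" by (auto simp: theta_def)
  qed
  then have "prefix_of start_bound ((1 + q ^ 1) * ((1 + q ^ 1) * ((1 + q ^ 1) * theta)))"
    unfolding start_bound_def by (intro prefix_of_shift_add)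
  also have "(1 + q ^ 1) * ((1 + q ^ 1) * ((1 + q ^ 1) * theta)) = crank_bound 1"
    by (simp add: power2_eq_square mult.assoc)
  finally show ?thesis .
qed

lemma check_run_sound:
  assumes "check_run f K r d" "prefix_of r (part_diff K)" "prefix_of d (crank_bound K)"
    and "length r = L" "length d = L" "K \<ge> 1" "K < K'" "K' \<le> K + f"
  shows "\<exists>r' d'. prefix_of r' (part_diff K') \<and> prefix_of d' (crank_bound K')
    \<and> length r' = L \<and> length d' = L \<and> checks K' r' d'"
  using assms
proof (induction f arbitrary: K r d)
  case (Suc f)
  define r' where "r' = mult_geom (Suc K) r"
  define d' where "d' = (if even K then shift_add (Suc K) d else d)"
  have c: "checks (Suc K) r' d'" "check_run f (Suc K) r' d'"
    using Suc.prems(1) by (simp_all add: r'_def d'_def Let_def)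
  have r': "prefix_of r' (part_diff (Suc K))" "length r' = L"
    using Suc.prems by (simp_all add: r'_def part_diff_Suc prefix_of_mult_geom)
  have d': "prefix_of d' (crank_bound (Suc K))" "length d' = L"
    using Suc.prems prefix_of_shift_add[of d "crank_bound K" "Suc K"] by (simp_all add: d'_def)
  show ?case
  proof (cases "K' = Suc K")
    case True
    then show ?thesis using c r' d' by blast
  next
    case False
    then show ?thesis using Suc.IH[OF c(2) r'(1) d'(1)] r' d' Suc.prems by simp
  qed
qed simp

lemma checks_coefficients:
  assumes "1 < K" "K \<le> 75"
  shows "5 \<le> K \<Longrightarrow> K < 12 \<Longrightarrow> i \<in> {30..<87} \<Longrightarrow> 0 \<le> part_diff K $ i"
    and "K = 12 \<Longrightarrow> i \<in> {75..<87} \<Longrightarrow> 12513 \<le> part_diff K $ i"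
    and "12 \<le> K \<Longrightarrow> i < 40 \<Longrightarrow> - 300 \<le> gap K i"
    and "12 \<le> K \<Longrightarrow> i \<in> {40..<75} \<Longrightarrow> 1 \<le> gap K i"
proof -
  obtain r d where r: "prefix_of r (part_diff K)" "length r = 87"
    and d: "prefix_of d (crank_bound K)" "length d = 87" and c: "checks K r d"
    using check_run_sound[OF check_run_start prefix_of_start_diff prefix_of_start_bound,
        of 87 K] assms by auto
  have nth: "r ! i = part_diff K $ i" "d ! i = crank_bound K $ i" if "i < 87" for i
    using r d that by (auto simp: prefix_of_def)
  note all_nth = list_all_length[THEN iffD1, THEN spec, THEN mp]
  show "0 \<le> part_diff K $ i" if "5 \<le> K" "K < 12" "i \<in> {30..<87}" for i
  proof -
    have "list_all (\<lambda>x. 0 \<le> x) (drop 30 r)" using c that by (simp add: checks_def)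
    from all_nth[OF this, of "i - 30"] show ?thesis
      using that r(2) nth by (simp add: less_diff_conv2)
  qed
  show "12513 \<le> part_diff K $ i" if "K = 12" "i \<in> {75..<87}" for i
  proof -
    have "list_all (\<lambda>x. 12513 \<le> x) (drop 75 r)" using c that by (simp add: checks_def)
    from all_nth[OF this, of "i - 75"] show ?thesis
      using that r(2) nth by (simp add: less_diff_conv2)
  qed
  show "- 300 \<le> gap K i" if "12 \<le> K" "i < 40" for i
  proof -
    have "list_all (\<lambda>x. - 300 \<le> x) (take 40 (map2 (-) r d))" using c that by (simp add: checks_def)
    from all_nth[OF this, of i] show ?thesis using that r(2) d(2) nth by (simp add: gap_def)
  qed
  show "1 \<le> gap K i" if "12 \<le> K" "i \<in> {40..<75}" for i
  proof -
    have "list_all (\<lambda>x. 1 \<le> x) (drop 40 (take 75 (map2 (-) r d)))"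
      using c that by (simp add: checks_def)
    from all_nth[OF this, of "i - 40"] show ?thesis
      using that r(2) d(2) nth by (simp add: gap_def less_diff_conv2)
  qed
qed

section \<open>Positivity of \<open>part_diff\<close> from finitely many coefficients\<close>

lemma geom_window:
  assumes "m > 0" and F: "\<And>n. a + m \<le> n \<Longrightarrow> 0 \<le> F $ n"
    and init: "\<And>n. n \<in> {a..<a + m} \<Longrightarrow> c \<le> (F * geom 1 m) $ n"
    and "a \<le> n"
  shows "c \<le> (F * geom 1 m) $ n"
  using \<open>a \<le> n\<close>
proof (induction n rule: less_induct)
  case (less n)
  show ?case
  proof (cases "n < a + m")
    case False
    \<comment> \<open>Past the first period the coefficient at n is the one at n - m plus a
      nonnegative term, so the bound passes along each residue class modulo m.\<close>
    then have "c \<le> (F * geom 1 m) $ (n - m)" using less \<open>m > 0\<close> by simp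
    then show ?thesis using nth_mult_geom[OF \<open>m > 0\<close>, of F 1 n] F[of n] False by simp
  qed (use init less.prems in auto)
qed

text \<open>Cancelling 1 - q leaves 1/((1 + q)(1 - q^3)), whose poles are simple and at sixth roots
  of unity; hence the period 6.\<close>

lemma nth_diff_23:
  "((1 - q) * geom 1 2 * geom 1 3) $ n
    = (if n mod 6 = 0 \<or> n mod 6 = 2 then 1 else if n mod 6 = 1 then - 1 else 0)"
proof (induction n rule: less_induct)
  case (less n)
  have "(1 - q) * geom 1 2 = geom (- 1) 1"
  proof -
    have "(1 - q) * (1 + q ^ 1) = 1 - q ^ 2" by (simp add: algebra_simps power2_eq_square)
    have "(1 - q) * geom 1 2 = (1 - q) * geom 1 2 * (geom (- 1) 1 * (1 + q ^ 1))"
      using geom_minus_1_cancel[of 1] by simp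
    also have "\<dots> = geom (- 1) 1 * (geom 1 2 * ((1 - q) * (1 + q ^ 1)))"
      by (simp only: mult_ac)
    also have "\<dots> = geom (- 1) 1"
      unfolding \<open>(1 - q) * (1 + q ^ 1) = 1 - q ^ 2\<close> using geom_1_cancel[of 2] by simp
    finally show ?thesis .
  qed
  then have "((1 - q) * geom 1 2) $ n = (- 1) ^ n" by (simp add: geom_def)
  then have rec: "((1 - q) * geom 1 2 * geom 1 3) $ n
      = (- 1) ^ n + (if 3 \<le> n then ((1 - q) * geom 1 2 * geom 1 3) $ (n - 3) else 0)"
    using nth_mult_geom[of 3 "(1 - q) * geom 1 2" 1 n] by simp
  show ?case
  proof (cases "n < 3")
    case True
    then have "n = 0 \<or> n = 1 \<or> n = 2" by auto
    then show ?thesis unfolding rec by auto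
  next
    case False
    have "(n - 3) mod 6 = (n mod 6 + 3) mod 6" using False by presburger
    moreover have "(- 1 :: int) ^ n = (if even (n mod 6) then 1 else - 1)"
      by (simp add: minus_one_power_iff dvd_mod_iff)
    moreover have "n mod 6 \<in> {0, 1, 2, 3, 4, 5}" by auto
    ultimately show ?thesis
      unfolding rec using less[of "n - 3"] False by (elim insertE) auto
  qed
qed

text \<open>Six steps of length 5 visit every residue modulo 6 once, and the series T of
  \<open>nth_diff_23\<close> has sum 1 over a period. So the coefficients grow by 1 every 30
  indices. The part 4 is left out here because T has to be periodic.\<close>

lemma diff_235_nonneg:
  assumes "n \<ge> 30"
  shows "0 \<le> ((1 - q) * geom 1 2 * geom 1 3 * geom 1 5) $ n"
proof -
  define T where "T = (1 - q) * geom 1 2 * geom 1 3"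
  define R where "R = T * geom 1 5"
  have T: "T $ n = (if n mod 6 = 0 \<or> n mod 6 = 2 then 1 else if n mod 6 = 1 then - 1 else 0)" for n
    unfolding T_def by (rule nth_diff_23)
  have rec: "R $ (k + 5) = T $ (k + 5) + R $ k" for k
    unfolding R_def by (subst nth_mult_geom) simp_all
  have "R $ (k + 30) = T $ (k + 30) + T $ (k + 25) + T $ (k + 20) + T $ (k + 15) + T $ (k + 10)
      + T $ (k + 5) + R $ k" for k
    using rec[of k] rec[of "k + 5"] rec[of "k + 10"] rec[of "k + 15"] rec[of "k + 20"] rec[of "k + 25"]
    by (simp add: add.assoc)
  moreover have "T $ (k + 30) + T $ (k + 25) + T $ (k + 20) + T $ (k + 15) + T $ (k + 10)
      + T $ (k + 5) = 1" for k
  proof -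
    define r where "r = k mod 6"
    have mods: "(k + c) mod 6 = (r + c) mod 6" for c unfolding r_def by (simp only: mod_add_left_eq)
    have "r \<in> {0, 1, 2, 3, 4, 5}" unfolding r_def by auto
    then show ?thesis unfolding T mods by (elim insertE) simp_all
  qed
  ultimately have period: "R $ (k + 30) = 1 + R $ k" for k by simp
  have "0 \<le> R $ n"
    using assms
  proof (induction n rule: less_induct)
    case (less n)
    show ?case
    proof (cases "n < 60")
      case True
      have "prefix_of (mult_geom 5 (mult_geom 3 (mult_geom 2 start_diff))) R"
        unfolding R_def T_def
        using prefix_of_start_diff by (intro prefix_of_mult_geom) (auto simp: part_diff_def)
      moreover have "0 \<le> drop 30 (mult_geom 5 (mult_geom 3 (mult_geom 2 start_diff))) ! (n - 30)"
        using check_235[unfolded list_all_length, THEN spec, of "n - 30"] True less.prems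
        by (simp add: less_diff_conv2)
      ultimately show ?thesis using True less.prems by (simp add: prefix_of_def)
    next
      case False
      then show ?thesis using period[of "n - 30"] less.IH[of "n - 30"] by simp
    qed
  qed
  then show ?thesis unfolding R_def T_def .
qed

lemma part_diff_nonneg:
  assumes "K \<in> {5..<12}" "n \<ge> 30"
  shows "0 \<le> part_diff K $ n"
proof -
  have "5 \<le> K \<Longrightarrow> K < 12 \<Longrightarrow> \<forall>n\<ge>30. 0 \<le> part_diff K $ n" for K
  proof (induction K rule: dec_induct)
    case base
    have "{2..5} = {2, 3, 4, 5 :: nat}" by auto
    \<comment> \<open>The factor for the part 4 is put last, so that \<open>geom_window\<close>
      applies to the series of \<open>diff_235_nonneg\<close>.\<close>
    then have eq: "part_diff 5 = (1 - q) * geom 1 2 * geom 1 3 * geom 1 5 * geom 1 4"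
      by (simp add: part_diff_def mult_ac)
    have "0 \<le> ((1 - q) * geom 1 2 * geom 1 3 * geom 1 5 * geom 1 4) $ n" if "n \<ge> 30" for n
    proof (rule geom_window[where a = 30])
      show "0 \<le> ((1 - q) * geom 1 2 * geom 1 3 * geom 1 5) $ n" if "30 + 4 \<le> n" for n
        using diff_235_nonneg that by simp
      show "0 \<le> ((1 - q) * geom 1 2 * geom 1 3 * geom 1 5 * geom 1 4) $ n" if "n \<in> {30..<30 + 4}" for n
        using checks_coefficients(1)[of 5 n] that unfolding eq by simp
    qed (use that in auto)
    then show ?case unfolding eq by blast
  next
    case (step K)
    show ?case
    proof (intro allI impI)
      fix n :: nat assume "n \<ge> 30"
      have "0 \<le> (part_diff K * geom 1 (Suc K)) $ n"
      proof (rule geom_window[where a = 30])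
        show "0 \<le> part_diff K $ n" if "30 + Suc K \<le> n" for n using step that by simp
        show "0 \<le> (part_diff K * geom 1 (Suc K)) $ n" if "n \<in> {30..<30 + Suc K}" for n
          using checks_coefficients(1)[of "Suc K" n] that step by (simp add: part_diff_Suc)
      qed (use \<open>n \<ge> 30\<close> in auto)
      then show "0 \<le> part_diff (Suc K) $ n" using step by (simp add: part_diff_Suc)
    qed
  qed
  then show ?thesis using assms by simp
qed

lemma part_diff_12: "n \<ge> 75 \<Longrightarrow> 12513 \<le> part_diff 12 $ n"
proof -
  assume "n \<ge> 75"
  have eq: "part_diff 12 = part_diff 11 * geom 1 12"
    using part_diff_Suc[of 11] by simp
  show ?thesis unfolding eq
  proof (rule geom_window[where a = 75])
    show "0 \<le> part_diff 11 $ n" if "75 + 12 \<le> n" for n using part_diff_nonneg that by simp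
    show "12513 \<le> (part_diff 11 * geom 1 12) $ n" if "n \<in> {75..<75 + 12}" for n
      using checks_coefficients(2)[of 12 n] that unfolding eq by simp
  qed (use \<open>n \<ge> 75\<close> in auto)
qed

section \<open>Lower bounds for the gap at every level from 12 on\<close>

lemma gap_small:
  assumes "K \<ge> 12"
  shows "n < 40 \<Longrightarrow> - 300 \<le> gap K n" and "n \<in> {40..<75} \<Longrightarrow> 1 \<le> gap K n"
proof -
  \<comment> \<open>Factors with exponents above 75 do not reach indices below 75, so the computed
    values at level 75 persist.\<close>
  have stable: "gap (75 + k) n = gap 75 n" if "n < 75" for k n
  proof (induction k)
    case (Suc k)
    then show ?case using gap_Suc_eq[of "75 + k" n] that by simp
  qed simp
  have cut: "gap K n = gap (min K 75) n" if "n < 75" for n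
    using stable[OF that, of "K - 75"] by (cases "K \<le> 75") simp_all
  have K: "1 < min K 75" "min K 75 \<le> 75" "12 \<le> min K 75" using assms by auto
  show "- 300 \<le> gap K n" if "n < 40"
    using checks_coefficients(3)[OF K that] that by (subst cut) simp_all
  show "1 \<le> gap K n" if "n \<in> {40..<75}"
    using checks_coefficients(4)[OF K that] that by (subst cut) simp_all
qed

text \<open>Passing from K to K + 1 adds at least the gap at n - K - 1, which can be negative (but not
  below -300) only when that index is below 40; the term 300 min(40, n - K) is the reserve for the
  losses still to come.\<close>

lemma gap_large:
  assumes "n \<ge> 75" "K \<ge> 12"
  shows "1 + 300 * int (min 40 (n - K)) \<le> gap K n"
  using assms
\<comment> \<open>K is arbitrary because the step from K uses the bound at the smaller index n - K -
  1 and at level K + 1.\<close>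
proof (induction n arbitrary: K rule: less_induct)
  case (less n)
  show ?case using less.prems(2)
  proof (induction K rule: dec_induct)
    case base
    show ?case
      using part_diff_12[OF less.prems(1)] crank_bound_bounds(2)[of 12 n] less.prems(1)
      by (simp add: gap_def)
  next
    case (step K)
    note ge = gap_Suc_ge[of K n]
    show ?case
    proof (cases "Suc K \<le> n")
      case True
      define j where "j = n - Suc K"
      have nK: "n - K = Suc j" "n - Suc K = j" using True by (auto simp: j_def)
      consider "j < 40" | "j \<in> {40..<75}" | "75 \<le> j" by fastforce
      then show ?thesis
      proof cases
        case 1
        \<comment> \<open>Here n - K = j + 1 is at most 40, so the reserve drops by exactly 300 and
          pays for the loss. In the other two cases it stays at 300 * 40 and the gap grows.\<close>
        then have "- 300 \<le> gap (Suc K) j" using gap_small step.hyps by simp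
        then show ?thesis using ge step.IH step.hyps True 1 unfolding nK by simp
      next
        case 2
        then have "1 \<le> gap (Suc K) j" using gap_small step.hyps by simp
        then show ?thesis using ge step.IH step.hyps True 2 unfolding nK by simp
      next
        case 3
        then have "1 + 300 * int (min 40 (j - Suc K)) \<le> gap (Suc K) j"
          using less.IH[of j "Suc K"] step.hyps True by (simp add: j_def)
        then show ?thesis using ge step.IH step.hyps True 3 unfolding nK by simp
      qed
    qed (use ge step in simp)
  qed
qed

lemma crank_bound_less_part_diff: "n \<ge> 40 \<Longrightarrow> K \<ge> 12 \<Longrightarrow> crank_bound K $ n < part_diff K $ n"
  using gap_large[of n K] gap_small(2)[of K n] by (cases "n < 75") (auto simp: gap_def)

section \<open>Second differences of the two series and conclusion\<close>

lemma crank_bound_even: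
  "crank_bound (2 * N) = (1 + q) ^ 2 * theta * (\<Prod>i=1..N. 1 + q ^ (2 * i - 1))"
  by (induction N) (simp_all add: mult_ac)

lemma second_difference_nth:
  assumes "n \<ge> 1"
  shows "((1 - q) ^ 2 * F) $ (n + 1) = F $ (n + 1) - 2 * F $ n + F $ (n - 1)"
proof -
  have "(1 - q) ^ 2 * F = F - fps_const 2 * (q ^ 1 * F) + q ^ 2 * F"
    by (simp add: algebra_simps power2_eq_square numeral_fps_const[symmetric])
  then show ?thesis using assms
    by (simp only: fps_add_nth fps_sub_nth fps_mult_left_const_nth fps_nth_q_power_mult) simp
qed

theorem theorem1p3:
  fixes k n :: nat
  assumes "k = 0 \<or> k = 1" and "n \<ge> 39"
  shows "M k (n - 1) + M k (n + 1) > 2 * M k n"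
proof -
  let ?N = "n + 1"
  define p where "p m = int (M 0 m) + int (M 1 m)" for m
  define a where "a m = int (M 0 m) - int (M 1 m)" for m
  \<comment> \<open>Level 2(n + 1) admits all parts up to n + 1 and, by
    \<open>crank_bound_even\<close>, comprises exactly n + 1 factors of odd exponent, as many as G
    below.\<close>
  have p: "p m = inv_qpoch (2 * ?N) $ m" if "m \<le> ?N" for m
    using card_partitions_eq_coeff[of m "2 * ?N"] M_add[of m] that by (simp add: p_def flip: of_nat_add)
  have "p (n + 1) - 2 * p n + p (n - 1) = ((1 - q) ^ 2 * inv_qpoch (2 * ?N)) $ (n + 1)"
    using assms(2) by (subst second_difference_nth) (simp_all add: p)
  also have "(1 - q) ^ 2 * inv_qpoch (2 * ?N) = part_diff (2 * ?N)"
    unfolding part_diff_def by (subst prod_geom_from_2) (simp_all add: power2_eq_square mult.assoc)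
  finally have p2: "p (n + 1) - 2 * p n + p (n - 1) = part_diff (2 * ?N) $ (n + 1)" .
  define G where "G = (1 + 2 * (\<Sum>s=1..?N. (- 1) ^ s * q ^ s\<^sup>2)) * (\<Prod>i=1..?N. 1 - q ^ (2 * i - 1))"
  have a: "a m = G $ m" if "2 \<le> m" "m \<le> ?N" for m
    using M_diff_eq_coeff[OF that] unfolding a_def G_def .
  have "a (n + 1) - 2 * a n + a (n - 1) = ((1 - q) ^ 2 * G) $ (n + 1)"
    using assms(2) by (subst second_difference_nth) (simp_all add: a)
  moreover have "dominated ((1 - q) ^ 2 * G) (crank_bound (2 * ?N))"
    unfolding G_def crank_bound_even power2_eq_square[of "1 - q"] power2_eq_square[of "1 + q"] mult.assoc
    using dominated_1_minus_q_power[of 1]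
    by (intro dominated_mult dominated_prod dominated_1_minus_q_power dominated_theta) simp_all
  ultimately have "\<bar>a (n + 1) - 2 * a n + a (n - 1)\<bar> \<le> crank_bound (2 * ?N) $ (n + 1)"
    by (simp add: dominated_def)
  \<comment> \<open>The hypothesis \<open>n >= 39\<close> puts the index n + 1 in the range from 40
    on.\<close>
  also have "\<dots> < p (n + 1) - 2 * p n + p (n - 1)"
    unfolding p2 using assms(2) by (intro crank_bound_less_part_diff) auto
  \<comment> \<open>Since 2 M_0 = p + a and 2 M_1 = p - a, a second difference of p that exceeds the
    absolute value of that of a settles both parities.\<close>
  finally show ?thesis using assms(1) unfolding a_def p_def by auto
qed

end
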